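(* Let $P=(\varphi_n)_{n=0}^\infty$ be a fixed sequence of functions as in the context, and let $(x_n)_{n=1}^\infty$ be a sequence of numbers from $(0,1]$. Then $$\lim_{n\to\infty}x_n=0\iff\lim_{n\to\infty}p_1(x_n)=\infty.$$
   Context: $\mathbb{N}=\{1,2,3,\ldots\}$. Fix a sequence $P=(\varphi_n)_{n=0}^\infty$, where $\varphi_0\in\mathbb{N}$ is a constant and, for $n\ge 1$, $\varphi_n\colon\mathbb{N}^n\to\mathbb{N}$ is an arbitrary function. The $P$-representation (positive Perron expansion) of $x\in(0,1]$ is the expansion $$x=\sum_{n=0}^{\infty}\frac{r_0 r_1\cdots r_n}{(p_1-1)p_1\cdots(p_n-1)p_n\,p_{n+1}},$$ where $p_1,p_2,\ldots\in\mathbb{N}$, $r_0=\varphi_0$, $r_n=\varphi_n(p_1,\ldots,p_n)$ and $p_n\ge r_{n-1}+1$ for all $n\in\mathbb{N}$ (the $n=0$ term is $r_0/p_1$). It is known that for every such $P$ each $x\in(0,1]$ has a unique $P$-representation; the number $p_n=p_n(x)$ is called the $n$th $P$-digit of $x$. *)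

theory Defs
  imports Complex_Main
begin

text \<open>
  A sequence \<open>(\<phi>\<^sub>n)\<close> consisting of a constant \<open>\<phi>\<^sub>0\<close> and functions \<open>\<phi>\<^sub>n\<close> of \<open>n\<close> positive integers is
  encoded as one function on lists: \<open>\<phi>\<^sub>n\<close> is \<open>\<phi>\<close> restricted to lists of length \<open>n\<close>, and \<open>\<phi>\<^sub>0 = \<phi> []\<close>.
  Values of \<open>\<phi>\<close> on lists containing \<open>0\<close> are irrelevant.
\<close>

definition perron_family :: "(nat list \<Rightarrow> nat) \<Rightarrow> bool" where
  "perron_family \<phi> \<longleftrightarrow> (\<forall>ps. (\<forall>q\<in>set ps. 0 < q) \<longrightarrow> 0 < \<phi> ps)"

text \<open>
  Digit sequences \<open>p\<close> are indexed from \<open>1\<close>; the value \<open>p 0\<close> is never used.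
  In particular \<open>perron_r \<phi> p n = \<phi> [p 1, \<dots>, p n]\<close>.
\<close>

definition perron_r :: "(nat list \<Rightarrow> nat) \<Rightarrow> (nat \<Rightarrow> nat) \<Rightarrow> nat \<Rightarrow> nat" where
  "perron_r \<phi> p n = \<phi> (map p [1..<Suc n])"

definition perron_term :: "(nat list \<Rightarrow> nat) \<Rightarrow> (nat \<Rightarrow> nat) \<Rightarrow> nat \<Rightarrow> real" where
  "perron_term \<phi> p n =
     (\<Prod>i=0..n. real (perron_r \<phi> p i)) /
     ((\<Prod>i=1..n. (real (p i) - 1) * real (p i)) * real (p (Suc n)))"

definition perron_representation :: "(nat list \<Rightarrow> nat) \<Rightarrow> real \<Rightarrow> (nat \<Rightarrow> nat) \<Rightarrow> bool" where
  "perron_representation \<phi> x p \<longleftrightarrow>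
     (\<forall>n\<ge>1. p n \<ge> perron_r \<phi> p (n - 1) + 1) \<and> perron_term \<phi> p sums x"

text \<open>
  The description quantifies over the digit rather than over the whole sequence because
  \<open>p 0\<close> is unconstrained. It is meaningful for \<open>n \<ge> 1\<close> and \<open>x \<in> {0<..1}\<close>.
\<close>

definition perron_digit :: "(nat list \<Rightarrow> nat) \<Rightarrow> nat \<Rightarrow> real \<Rightarrow> nat" where
  "perron_digit \<phi> n x = (THE d. \<exists>p. perron_representation \<phi> x p \<and> p n = d)"

end

theory Submission
  imports Defs
begin

text \<open>
  Write \<open>c\<^sub>n = r\<^sub>0 \<cdots> r\<^sub>n\<^sub>-\<^sub>1 / ((p\<^sub>1 - 1) p\<^sub>1 \<cdots> (p\<^sub>n - 1) p\<^sub>n)\<close>, so that the \<open>n\<close>th term of the expansion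
  is \<open>c\<^sub>n r\<^sub>n / p\<^sub>n\<^sub>+\<^sub>1\<close>. The partial fraction identity \<open>1/p + 1/((p - 1) p) = 1/(p - 1)\<close> says that this
  term plus \<open>c\<^sub>n\<^sub>+\<^sub>1\<close> equals \<open>c\<^sub>n r\<^sub>n / (p\<^sub>n\<^sub>+\<^sub>1 - 1)\<close>, which is at most \<open>c\<^sub>n\<close> because \<open>p\<^sub>n\<^sub>+\<^sub>1 \<ge> r\<^sub>n + 1\<close>.
  Hence everything after the first term sums to at most \<open>c\<^sub>1\<close>, and since all terms are positive,
  \<open>r\<^sub>0 / p\<^sub>1 < x \<le> r\<^sub>0 / (p\<^sub>1 - 1)\<close> for every representation of \<open>x\<close>. This pins the first digit down as
  \<open>p\<^sub>1 = \<lfloor>r\<^sub>0 / x\<rfloor> + 1\<close> (lemma \<open>perron_digit_1_eq\<close>), and the equivalence of \<open>x\<^sub>n \<longlonglongrightarrow> 0\<close> with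
  \<open>p\<^sub>1(x\<^sub>n) \<longlonglongrightarrow> \<infinity>\<close> is read off from the two inequalities.

  As the digit is a definite description, some representation of \<open>x\<close> has to exist. The same
  two inequalities dictate a greedy algorithm: choose each digit as the floor expression for the
  current remainder in \<open>(0,1]\<close>, and rescale what is left over back into \<open>(0,1]\<close>. The error after
  \<open>n\<close> steps is at most \<open>c\<^sub>n \<le> 2\<^sup>-\<^sup>n\<close>.
\<close>

section \<open>Weights and bounds for admissible digit sequences\<close>

definition perron_admissible :: "(nat list \<Rightarrow> nat) \<Rightarrow> (nat \<Rightarrow> nat) \<Rightarrow> bool" where
  "perron_admissible \<phi> p \<longleftrightarrow> (\<forall>n. p (Suc n) \<ge> perron_r \<phi> p n + 1)"

definition perron_weight :: "(nat list \<Rightarrow> nat) \<Rightarrow> (nat \<Rightarrow> nat) \<Rightarrow> nat \<Rightarrow> real" where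
  "perron_weight \<phi> p n =
     (\<Prod>i<n. real (perron_r \<phi> p i)) / (\<Prod>i=1..n. (real (p i) - 1) * real (p i))"

lemma perron_representation_iff:
  "perron_representation \<phi> x p \<longleftrightarrow> perron_admissible \<phi> p \<and> perron_term \<phi> p sums x"
proof -
  have "(\<forall>n\<ge>1. p n \<ge> perron_r \<phi> p (n - 1) + 1) \<longleftrightarrow> (\<forall>n. p (Suc n) \<ge> perron_r \<phi> p n + 1)"
    by (metis One_nat_def Suc_le_D diff_Suc_1 le_add1 plus_1_eq_Suc)
  then show ?thesis
    by (simp add: perron_representation_def perron_admissible_def)
qed

lemma perron_weight_0 [simp]: "perron_weight \<phi> p 0 = 1"
  by (simp add: perron_weight_def)

lemma perron_weight_Suc:
  "perron_weight \<phi> p (Suc n) =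
     perron_weight \<phi> p n * (real (perron_r \<phi> p n) / ((real (p (Suc n)) - 1) * real (p (Suc n))))"
  by (simp add: perron_weight_def)

lemma perron_term_eq_weight:
  "perron_term \<phi> p n = perron_weight \<phi> p n * (real (perron_r \<phi> p n) / real (p (Suc n)))"
proof -
  have "{0..n} = {..<Suc n}"
    by auto
  then show ?thesis
    by (simp add: perron_term_def perron_weight_def)
qed

lemma perron_r_0: "perron_r \<phi> p 0 = \<phi> []"
  by (simp add: perron_r_def)

lemma perron_r_pos:
  assumes "perron_family \<phi>" and "\<And>i. 0 < p (Suc i)"
  shows "0 < perron_r \<phi> p n"
proof -
  have "\<forall>q\<in>set (map p [1..<Suc n]). 0 < q"
    using assms(2) by (auto simp: Suc_le_eq gr0_conv_Suc)
  then show ?thesis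
    using assms(1) unfolding perron_family_def perron_r_def by blast
qed

lemma perron_digit_bounds:
  assumes "perron_family \<phi>" and "perron_admissible \<phi> p"
  shows "real (p (Suc n)) \<ge> real (perron_r \<phi> p n) + 1" and "real (perron_r \<phi> p n) \<ge> 1"
proof -
  have admissible: "p (Suc i) \<ge> perron_r \<phi> p i + 1" for i
    using assms(2) unfolding perron_admissible_def by blast
  then show "real (p (Suc n)) \<ge> real (perron_r \<phi> p n) + 1"
    using admissible[of n] by linarith
  have "0 < p (Suc i)" for i
    using admissible[of i] by linarith
  then have "0 < perron_r \<phi> p n"
    by (rule perron_r_pos[OF assms(1)])
  then show "real (perron_r \<phi> p n) \<ge> 1"
    by linarith
qed

lemma perron_weight_pos:
  assumes "perron_family \<phi>" and "perron_admissible \<phi> p"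
  shows "perron_weight \<phi> p n > 0"
proof (induction n)
  case (Suc n)
  then show ?case
    using perron_digit_bounds[OF assms, of n]
    by (simp add: perron_weight_Suc)
qed simp

lemma perron_term_pos:
  assumes "perron_family \<phi>" and "perron_admissible \<phi> p"
  shows "perron_term \<phi> p n > 0"
  using perron_digit_bounds[OF assms, of n] perron_weight_pos[OF assms, of n]
  by (simp add: perron_term_eq_weight)

lemma perron_term_plus_weight:
  assumes "perron_family \<phi>" and "perron_admissible \<phi> p"
  shows "perron_term \<phi> p n + perron_weight \<phi> p (Suc n) =
    perron_weight \<phi> p n * (real (perron_r \<phi> p n) / (real (p (Suc n)) - 1))"
proof -
  have "r / q + r / ((q - 1) * q) = r / (q - 1)" if "q > 1" for q r :: real
    using that by (simp add: field_simps)
  moreover have "real (p (Suc n)) > 1"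
    using perron_digit_bounds[OF assms, of n] by linarith
  ultimately show ?thesis
    by (simp add: perron_term_eq_weight perron_weight_Suc flip: distrib_left)
qed

lemma perron_term_plus_weight_le:
  assumes "perron_family \<phi>" and "perron_admissible \<phi> p"
  shows "perron_term \<phi> p n + perron_weight \<phi> p (Suc n) \<le> perron_weight \<phi> p n"
proof -
  have "real (perron_r \<phi> p n) / (real (p (Suc n)) - 1) \<le> 1"
    using perron_digit_bounds[OF assms, of n] by simp
  then show ?thesis
    unfolding perron_term_plus_weight[OF assms]
    using perron_weight_pos[OF assms, of n] by (intro mult_left_le) auto
qed

text \<open>
  Appending the weight \<open>c\<^sub>n\<close> to the \<open>n\<close>th partial sum gives a decreasing sequence, so the value of
  that sequence at \<open>n = 1\<close> bounds the whole sum.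
\<close>

lemma perron_first_digit_bounds:
  assumes "perron_family \<phi>" and "perron_representation \<phi> x p"
  shows "real (\<phi> []) / real (p 1) < x" and "x \<le> real (\<phi> []) / (real (p 1) - 1)"
proof -
  have adm: "perron_admissible \<phi> p" and sums: "perron_term \<phi> p sums x"
    using assms(2) by (auto simp: perron_representation_iff)
  have "sum (perron_term \<phi> p) {..<1} < suminf (perron_term \<phi> p)"
    using sums perron_term_pos[OF assms(1) adm]
    by (intro sum_less_suminf) (auto simp: sums_iff)
  then show "real (\<phi> []) / real (p 1) < x"
    using sums by (simp add: sums_iff perron_term_eq_weight perron_r_0)
  have partial: "sum (perron_term \<phi> p) {..<Suc n} + perron_weight \<phi> p (Suc n)
      \<le> real (\<phi> []) / (real (p 1) - 1)" for n
  proof (induction n)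
    case 0
    then show ?case
      using perron_term_plus_weight[OF assms(1) adm, of 0] by (simp add: perron_r_0)
  next
    case (Suc n)
    then show ?case
      using perron_term_plus_weight_le[OF assms(1) adm, of "Suc n"] by simp
  qed
  have "(\<lambda>n. sum (perron_term \<phi> p) {..<Suc n}) \<longlonglongrightarrow> x"
    using sums unfolding sums_def by (rule LIMSEQ_Suc)
  moreover have "sum (perron_term \<phi> p) {..<Suc n} \<le> real (\<phi> []) / (real (p 1) - 1)" for n
    using partial[of n] perron_weight_pos[OF assms(1) adm, of "Suc n"] by linarith
  ultimately show "x \<le> real (\<phi> []) / (real (p 1) - 1)"
    by (intro LIMSEQ_le_const2) auto
qed

text \<open>
  In \<open>r\<^sub>n / ((p\<^sub>n\<^sub>+\<^sub>1 - 1) p\<^sub>n\<^sub>+\<^sub>1)\<close> the first factor of the denominator absorbs \<open>r\<^sub>n\<close>, and the second one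
  is at least \<open>2\<close>.
\<close>

lemma perron_weight_le:
  assumes "perron_family \<phi>" and "perron_admissible \<phi> p"
  shows "perron_weight \<phi> p n \<le> (1/2) ^ n"
proof (induction n)
  case (Suc n)
  have "r / ((q - 1) * q) \<le> 1/2" if "q \<ge> r + 1" "r \<ge> 1" for q r :: real
  proof -
    have "r * 2 \<le> (q - 1) * q"
      using that by (intro mult_mono) auto
    then show ?thesis
      using that by (simp add: field_simps)
  qed
  then have "real (perron_r \<phi> p n) / ((real (p (Suc n)) - 1) * real (p (Suc n))) \<le> 1/2"
    using perron_digit_bounds[OF assms, of n] by blast
  then have "perron_weight \<phi> p (Suc n) \<le> perron_weight \<phi> p n * (1/2)"
    unfolding perron_weight_Suc
    using perron_weight_pos[OF assms, of n] by (intro mult_left_mono) auto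
  then show ?case
    using Suc by simp
qed simp

section \<open>Existence of representations by the greedy algorithm\<close>

text \<open>
  For \<open>0 < y \<le> r\<close>, the unique \<open>d \<ge> 2\<close> with \<open>r / d < y \<le> r / (d - 1)\<close>.
\<close>

definition greedy_digit :: "nat \<Rightarrow> real \<Rightarrow> nat" where
  "greedy_digit r y = nat \<lfloor>real r / y\<rfloor> + 1"

text \<open>
  What is left of \<open>y\<close> after removing \<open>r / d\<close>, in units of the factor
  \<open>r / ((d - 1) d)\<close> by which the weight changes.
\<close>

definition greedy_remainder :: "nat \<Rightarrow> real \<Rightarrow> real" where
  "greedy_remainder r y =
     (let d = real (greedy_digit r y) in (y - real r / d) * ((d - 1) * d / real r))"

text \<open>
  The state carries the list of digits found so far because the next \<open>r\<^sub>n\<close> depends on all of them.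
\<close>

primrec greedy_state :: "(nat list \<Rightarrow> nat) \<Rightarrow> real \<Rightarrow> nat \<Rightarrow> nat list \<times> real" where
  "greedy_state \<phi> x 0 = ([], x)"
| "greedy_state \<phi> x (Suc n) =
     (let (ps, y) = greedy_state \<phi> x n
      in (ps @ [greedy_digit (\<phi> ps) y], greedy_remainder (\<phi> ps) y))"

definition greedy_digits :: "(nat list \<Rightarrow> nat) \<Rightarrow> real \<Rightarrow> nat \<Rightarrow> nat" where
  "greedy_digits \<phi> x n = last (fst (greedy_state \<phi> x n))"

lemma greedy_digit_unique:
  assumes "0 < y" and "real r / real d < y" and "y \<le> real r / (real d - 1)" and "d \<ge> 2"
  shows "d = greedy_digit r y"
proof -
  have "real d - 1 \<le> real r / y" and "real r / y < real d"
    using assms by (simp_all add: field_simps)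
  then have "\<lfloor>real r / y\<rfloor> = int d - 1"
    by (intro floor_unique) auto
  then show ?thesis
    using assms(4) by (simp add: greedy_digit_def)
qed

lemma greedy_digit_bounds:
  assumes "0 < y" and "y \<le> 1" and "0 < r"
  shows "r + 1 \<le> greedy_digit r y"
    and "real r / real (greedy_digit r y) < y"
    and "y \<le> real r / (real (greedy_digit r y) - 1)"
proof -
  have "real r \<le> real r / y"
    using assms by (simp add: field_simps)
  then have "int r \<le> \<lfloor>real r / y\<rfloor>"
    by (simp add: le_floor_iff)
  then show digit: "r + 1 \<le> greedy_digit r y"
    unfolding greedy_digit_def by linarith
  have real_digit: "real (greedy_digit r y) = of_int \<lfloor>real r / y\<rfloor> + 1"
    using \<open>int r \<le> \<lfloor>real r / y\<rfloor>\<close> by (simp add: greedy_digit_def)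
  have "real r / y < real (greedy_digit r y)" and "real (greedy_digit r y) - 1 \<le> real r / y"
    unfolding real_digit by linarith+
  moreover have "real (greedy_digit r y) - 1 > 0"
    using digit assms(3) by linarith
  ultimately show "real r / real (greedy_digit r y) < y"
    and "y \<le> real r / (real (greedy_digit r y) - 1)"
    using assms by (simp_all add: field_simps)
qed

lemma greedy_remainder_bounds:
  assumes "0 < y" and "y \<le> 1" and "0 < r"
  shows "0 < greedy_remainder r y" and "greedy_remainder r y \<le> 1"
proof -
  define d where "d = real (greedy_digit r y)"
  have d: "d \<ge> real r + 1" "real r / d < y" "y \<le> real r / (d - 1)"
    using greedy_digit_bounds[OF assms] unfolding d_def by linarith+
  have rem: "greedy_remainder r y = (y - real r / d) * ((d - 1) * d / real r)"
    by (simp add: greedy_remainder_def d_def Let_def)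
  have factor: "(d - 1) * d / real r > 0"
    using d(1) assms(3) by simp
  then show "0 < greedy_remainder r y"
    unfolding rem using d(2) by (intro mult_pos_pos) auto
  have "greedy_remainder r y \<le> (real r / (d - 1) - real r / d) * ((d - 1) * d / real r)"
    unfolding rem using d(3) factor by (intro mult_right_mono) auto
  also have "\<dots> = 1"
    using d(1) assms(3) by (simp add: field_simps)
  finally show "greedy_remainder r y \<le> 1" .
qed

lemma fst_greedy_state: "fst (greedy_state \<phi> x n) = map (greedy_digits \<phi> x) [1..<Suc n]"
proof (induction n)
  case (Suc n)
  have "fst (greedy_state \<phi> x (Suc n)) =
      fst (greedy_state \<phi> x n) @ [greedy_digits \<phi> x (Suc n)]"
    by (simp add: greedy_digits_def Let_def split: prod.split)
  then show ?case
    using Suc by simp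
qed simp

lemma perron_r_greedy_digits:
  "perron_r \<phi> (greedy_digits \<phi> x) n = \<phi> (fst (greedy_state \<phi> x n))"
  by (simp only: perron_r_def fst_greedy_state)

lemma greedy_digits_Suc:
  "greedy_digits \<phi> x (Suc n) =
     greedy_digit (perron_r \<phi> (greedy_digits \<phi> x) n) (snd (greedy_state \<phi> x n))"
  unfolding perron_r_greedy_digits by (simp add: greedy_digits_def case_prod_unfold Let_def)

lemma snd_greedy_state_Suc:
  "snd (greedy_state \<phi> x (Suc n)) =
     greedy_remainder (perron_r \<phi> (greedy_digits \<phi> x) n) (snd (greedy_state \<phi> x n))"
  unfolding perron_r_greedy_digits by (simp add: case_prod_unfold Let_def)

text \<open>
  Positivity of \<open>r\<^sub>n\<close> is only guaranteed on lists of positive digits, but greedy digits are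
  successors and hence positive no matter what the remainders are.
\<close>

lemma greedy_perron_r_pos:
  assumes "perron_family \<phi>"
  shows "0 < perron_r \<phi> (greedy_digits \<phi> x) n"
  by (intro perron_r_pos assms) (simp add: greedy_digits_Suc greedy_digit_def)

lemma snd_greedy_state_bounds:
  assumes "perron_family \<phi>" and "0 < x" and "x \<le> 1"
  shows "0 < snd (greedy_state \<phi> x n) \<and> snd (greedy_state \<phi> x n) \<le> 1"
proof (induction n)
  case (Suc n)
  then show ?case
    unfolding snd_greedy_state_Suc
    by (intro conjI greedy_remainder_bounds greedy_perron_r_pos assms(1)) auto
qed (simp add: assms)

lemma perron_admissible_greedy_digits:
  assumes "perron_family \<phi>" and "0 < x" and "x \<le> 1"
  shows "perron_admissible \<phi> (greedy_digits \<phi> x)"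
proof -
  have "perron_r \<phi> (greedy_digits \<phi> x) n + 1 \<le> greedy_digits \<phi> x (Suc n)" for n
    unfolding greedy_digits_Suc[of _ _ n]
    using snd_greedy_state_bounds[OF assms, of n]
    by (intro greedy_digit_bounds(1) greedy_perron_r_pos assms(1)) auto
  then show ?thesis
    by (simp add: perron_admissible_def)
qed

text \<open>
  The invariant behind the algorithm: the error of the \<open>n\<close>th partial sum is \<open>c\<^sub>n\<close> times the current
  remainder.
\<close>

lemma greedy_partial_sum:
  assumes "perron_family \<phi>" and "0 < x" and "x \<le> 1"
  shows "(\<Sum>i<n. perron_term \<phi> (greedy_digits \<phi> x) i) +
    perron_weight \<phi> (greedy_digits \<phi> x) n * snd (greedy_state \<phi> x n) = x"
proof (induction n)
  case (Suc n)
  define p where "p = greedy_digits \<phi> x"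
  define y where "y = snd (greedy_state \<phi> x n)"
  define r where "r = real (perron_r \<phi> p n)"
  define d where "d = real (p (Suc n))"
  define c where "c = perron_weight \<phi> p n"
  have adm: "perron_admissible \<phi> p"
    unfolding p_def by (rule perron_admissible_greedy_digits[OF assms])
  have bounds: "d \<ge> r + 1" "r \<ge> 1"
    unfolding d_def r_def using perron_digit_bounds[OF assms(1) adm, of n] by blast+
  have next_remainder: "snd (greedy_state \<phi> x (Suc n)) = (y - r / d) * ((d - 1) * d / r)"
    unfolding snd_greedy_state_Suc greedy_remainder_def d_def r_def y_def p_def greedy_digits_Suc
    by (simp add: Let_def)
  have "perron_term \<phi> p n + perron_weight \<phi> p (Suc n) * snd (greedy_state \<phi> x (Suc n)) =
      c * (r / d) + c * (r / ((d - 1) * d)) * ((y - r / d) * ((d - 1) * d / r))"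
    unfolding next_remainder perron_term_eq_weight perron_weight_Suc c_def r_def d_def ..
  also have "(y - r / d) * ((d - 1) * d / r) = (y - r / d) / (r / ((d - 1) * d))"
    by simp
  also have "c * (r / ((d - 1) * d)) * \<dots> = c * (y - r / d)"
    using bounds by simp
  also have "c * (r / d) + \<dots> = c * y"
    by (simp add: algebra_simps)
  finally show ?case
    using Suc by (simp add: p_def c_def y_def)
qed simp

lemma perron_representation_greedy_digits:
  assumes "perron_family \<phi>" and "0 < x" and "x \<le> 1"
  shows "perron_representation \<phi> x (greedy_digits \<phi> x)"
proof -
  define p where "p = greedy_digits \<phi> x"
  define y where "y = (\<lambda>n. snd (greedy_state \<phi> x n))"
  have adm: "perron_admissible \<phi> p"
    unfolding p_def by (rule perron_admissible_greedy_digits[OF assms])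
  have y: "0 < y n" "y n \<le> 1" for n
    using snd_greedy_state_bounds[OF assms] by (auto simp: y_def)
  have lower: "0 \<le> perron_weight \<phi> p n * y n" for n
    using perron_weight_pos[OF assms(1) adm, of n] y(1)[of n] by simp
  have upper: "perron_weight \<phi> p n * y n \<le> (1/2) ^ n" for n
  proof -
    have "perron_weight \<phi> p n * y n \<le> (1/2) ^ n * 1"
      using perron_weight_le[OF assms(1) adm] y[of n] by (intro mult_mono) auto
    then show ?thesis
      by simp
  qed
  have geometric: "(\<lambda>n. (1/2) ^ n) \<longlonglongrightarrow> (0::real)"
    by (intro LIMSEQ_power_zero) simp
  have "(\<lambda>n. perron_weight \<phi> p n * y n) \<longlonglongrightarrow> 0"
    by (rule tendsto_sandwich[OF _ _ tendsto_const geometric]) (simp_all add: lower upper)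
  then have "(\<lambda>n. x - perron_weight \<phi> p n * y n) \<longlonglongrightarrow> x - 0"
    by (intro tendsto_diff tendsto_const)
  moreover have "sum (perron_term \<phi> p) {..<n} = x - perron_weight \<phi> p n * y n" for n
    using greedy_partial_sum[OF assms, of n] by (simp add: p_def y_def)
  ultimately have "perron_term \<phi> p sums x"
    by (simp add: sums_def)
  then show ?thesis
    using adm by (simp add: perron_representation_iff p_def)
qed

section \<open>The first digit\<close>

lemma perron_digit_1_eq:
  assumes "perron_family \<phi>" and "0 < x" and "x \<le> 1"
  shows "perron_digit \<phi> 1 x = greedy_digit (\<phi> []) x"
proof -
  have first: "p 1 = greedy_digit (\<phi> []) x" if rep: "perron_representation \<phi> x p" for p
  proof -
    have "perron_admissible \<phi> p"
      using rep by (simp add: perron_representation_iff)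
    then have "real (p 1) \<ge> 2"
      using perron_digit_bounds[OF assms(1), of p 0] by simp
    then show ?thesis
      using perron_first_digit_bounds[OF assms(1) rep] assms(2)
      by (intro greedy_digit_unique) auto
  qed
  show ?thesis
    unfolding perron_digit_def
    using first perron_representation_greedy_digits[OF assms] by (intro the_equality) blast+
qed

theorem proposition5:
  fixes \<phi> :: "nat list \<Rightarrow> nat" and x :: "nat \<Rightarrow> real"
  assumes "perron_family \<phi>"
    and "\<And>n. n \<ge> 1 \<Longrightarrow> x n \<in> {0<..1}"
  shows "x \<longlonglongrightarrow> 0 \<longleftrightarrow>
    filterlim (\<lambda>n. perron_digit \<phi> 1 (x n)) at_top sequentially"
proof -
  define r where "r = real (\<phi> [])"
  define p where "p = (\<lambda>n. perron_digit \<phi> 1 (x n))"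
  have "0 < \<phi> []"
    using assms(1) by (simp add: perron_family_def)
  then have r: "r > 0"
    by (simp add: r_def)
  have bounds: "0 < x n \<and> r / x n \<le> real (p n) \<and> x n \<le> r / (real (p n) - 1)"
    if "n \<ge> 1" for n
  proof -
    have x: "0 < x n" "x n \<le> 1"
      using assms(2)[OF that] by auto
    have p: "p n = greedy_digit (\<phi> []) (x n)"
      unfolding p_def by (rule perron_digit_1_eq[OF assms(1) x])
    note greedy = greedy_digit_bounds[OF x \<open>0 < \<phi> []\<close>, folded p r_def]
    have "0 < real (p n)"
      using greedy(1) by simp
    then have "r / x n \<le> real (p n)"
      using greedy(2) x(1) by (simp add: field_simps)
    then show ?thesis
      using greedy(3) x(1) by blast
  qed
  have real_p: "filterlim p at_top sequentially \<longleftrightarrow>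
      filterlim (\<lambda>n. real (p n)) at_top sequentially"
    by (rule filterlim_sequentially_iff_filterlim_real)
  have "x \<longlonglongrightarrow> 0 \<longleftrightarrow> filterlim (\<lambda>n. real (p n)) at_top sequentially"
  proof
    assume "x \<longlonglongrightarrow> 0"
    moreover have "eventually (\<lambda>n. 0 < x n) sequentially"
      using bounds by (intro eventually_sequentiallyI[of 1]) blast
    ultimately have "filterlim (\<lambda>n. r / x n) at_top sequentially"
      using r by (intro LIM_at_top_divide[OF tendsto_const])
    then show "filterlim (\<lambda>n. real (p n)) at_top sequentially"
      by (rule filterlim_at_top_mono) (use bounds in \<open>blast intro: eventually_sequentiallyI[of 1]\<close>)
  next
    assume "filterlim (\<lambda>n. real (p n)) at_top sequentially"
    then have "filterlim (\<lambda>n. -1 + real (p n)) at_top sequentially"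
      by (intro filterlim_tendsto_add_at_top[OF tendsto_const])
    then have "(\<lambda>n. r / (-1 + real (p n))) \<longlonglongrightarrow> 0"
      by (intro real_tendsto_divide_at_top[OF tendsto_const])
    then have upper: "(\<lambda>n. r / (real (p n) - 1)) \<longlonglongrightarrow> 0"
      by simp
    show "x \<longlonglongrightarrow> 0"
    proof (rule tendsto_sandwich[OF _ _ tendsto_const upper])
      show "eventually (\<lambda>n. 0 \<le> x n) sequentially"
        using bounds by (intro eventually_sequentiallyI[of 1]) (simp add: less_imp_le)
      show "eventually (\<lambda>n. x n \<le> r / (real (p n) - 1)) sequentially"
        using bounds by (intro eventually_sequentiallyI[of 1]) blast
    qed
  qed
  then show ?thesis
    using real_p by (simp add: p_def)
qed

end
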